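(* Let $\beta=(\beta_1,\beta_2,\dots)$ be an integer sequence, let $\mu$ be a partition with $l=l(\mu)$, and let $p$ and $e$ be positive integers. Let $\beta'=(\beta_1,\dots,\beta_l,\beta_e-p)$. Then $$h_{p,\beta_e}\,s_{\mu,\beta}=\sum_{\sigma}s_{\mu+\sigma,\ \beta'+\sigma},$$ where the sum is over all compositions $\sigma$ with $p$ boxes (i.e. $\sum_i\sigma_i=p$) and of length at most $l+1$.
   Context: An integer sequence is a sequence $(\alpha_1,\alpha_2,\dots)$ of integers; sums of integer sequences are taken entrywise. An integer vector is an integer sequence with finitely many nonzero entries; its length $l(\alpha)$ is the index of its rightmost nonzero entry (and $0$ for the zero sequence). A composition is an integer vector with all entries nonnegative, and a partition is a composition with weakly decreasing entries. The number of boxes of a composition is the sum of its entries. Let $A$ be the commutative ring generated over $\mathbb{Z}$ by independent indeterminates $h_{r,s}$ ($r\ge 1$, $s\in\mathbb{Z}$); set $h_{0,s}=1$ and $h_{r,s}=0$ for $r<0$, for all $s\in\mathbb{Z}$. For an integer vector $\mu$ with $l=l(\mu)$ and an integer sequence $\beta$, put $h_{\mu,\beta}=h_{\mu_1,\beta_1}\cdots h_{\mu_l,\beta_l}$. For $1\le s<t$ the raising operator $R_{st}$ acts on integer sequences by adding $1$ to the $s$-th entry and subtracting $1$ from the $t$-th entry. A monomial $R$ in the raising operators acts by $R\,h_{\mu,\beta}=h_{R\mu,R\beta}$. The Schur polynomial of the pair $(\mu,\beta)$ is $$s_{\mu,\beta}=\prod_{1\le s<t\le l}(1-R_{st})\,h_{\mu,\beta},$$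 expanded formally as a signed sum of terms $h_{R\mu,R\beta}$; equivalently, $s_{\mu,\beta}=\det\big(h_{\mu_i+j-i,\ \beta_i+j-i}\big)_{1\le i,j\le l}$. Only the first $l(\mu)$ entries of $\beta$ matter, so $s_{\mu+\sigma,\beta'+\sigma}$ is defined although $\beta'$ has only $l+1$ listed entries. *)

theory Defs
  imports Main "HOL-Library.Poly_Mapping" "HOL-Library.Function_Algebras"
begin

text \<open>
  Integer sequences are functions \<open>nat \<Rightarrow> int\<close> with entries counted from 0: \<open>\<alpha> i\<close> is the entry
  with index \<open>i + 1\<close> in the usual one-based notation.
  Sums of sequences are the entrywise sums of \<^theory>\<open>HOL-Library.Function_Algebras\<close>.
\<close>

type_synonym int_seq = "nat \<Rightarrow> int"

definition int_vector :: "int_seq \<Rightarrow> bool" where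
  "int_vector \<alpha> \<longleftrightarrow> finite {i. \<alpha> i \<noteq> 0}"

definition len :: "int_seq \<Rightarrow> nat" where
  \<comment> \<open>the one-based index of the rightmost nonzero entry, hence the successor\<close>
  "len \<alpha> = (if \<alpha> = 0 then 0 else Suc (Max {i. \<alpha> i \<noteq> 0}))"

definition is_composition :: "int_seq \<Rightarrow> bool" where
  "is_composition \<alpha> \<longleftrightarrow> int_vector \<alpha> \<and> (\<forall>i. 0 \<le> \<alpha> i)"

definition is_partition :: "int_seq \<Rightarrow> bool" where
  "is_partition \<alpha> \<longleftrightarrow> is_composition \<alpha> \<and> antimono \<alpha>"

definition boxes :: "int_seq \<Rightarrow> int" where
  "boxes \<alpha> = (\<Sum>i | \<alpha> i \<noteq> 0. \<alpha> i)"

text \<open>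
  The polynomial ring over the integers in the indeterminates \<open>h\<^bsub>r,s\<^esub>\<close> with \<open>r \<ge> 1\<close>. Monomials are
  finitely supported exponent functions; the variable index \<open>(k, s)\<close> stands for \<open>h\<^bsub>k+1,s\<^esub>\<close>, so that
  there are no superfluous variables.
\<close>

type_synonym h_ring = "((nat \<times> int) \<Rightarrow>\<^sub>0 nat) \<Rightarrow>\<^sub>0 int"

definition h :: "int \<Rightarrow> int \<Rightarrow> h_ring" where
  "h r s = (if r < 0 then 0 else if r = 0 then 1
            else Poly_Mapping.single (Poly_Mapping.single (nat (r - 1), s) 1) 1)"

definition h_prod :: "int_seq \<Rightarrow> int_seq \<Rightarrow> h_ring" where
  "h_prod \<mu> \<beta> = (\<Prod>i<len \<mu>. h (\<mu> i) (\<beta> i))"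

definition raising :: "nat \<times> nat \<Rightarrow> int_seq \<Rightarrow> int_seq" where
  "raising = (\<lambda>(s, t) \<alpha> i. \<alpha> i + (if i = s then 1 else 0) - (if i = t then 1 else 0))"

text \<open>
  The action of the squarefree monomial given by the product of the (commuting) raising
  operators indexed by the pairs in \<open>S\<close>.
\<close>

definition raising_monomial :: "(nat \<times> nat) set \<Rightarrow> int_seq \<Rightarrow> int_seq" where
  "raising_monomial S \<alpha> = Finite_Set.fold raising \<alpha> S"

interpretation raising: comp_fun_commute raising
  by standard (auto simp: raising_def fun_eq_iff split: prod.splits)

lemma raising_monomial_empty [simp]: "raising_monomial {} \<alpha> = \<alpha>"
  by (simp add: raising_monomial_def)

lemma raising_monomial_insert:
  assumes "finite S" "x \<notin> S"
  shows "raising_monomial (insert x S) \<alpha> = raising x (raising_monomial S \<alpha>)"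
  using assms by (simp add: raising_monomial_def)

definition positive_pairs :: "nat \<Rightarrow> (nat \<times> nat) set" where
  "positive_pairs l = {(s, t). s < t \<and> t < l}"

text \<open>
  The product of all \<open>1 - R\<^bsub>st\<^esub>\<close> with \<open>s < t \<le> l\<close>, multiplied out: choosing \<open>- R\<^bsub>st\<^esub>\<close> exactly in the
  factors indexed by \<open>S\<close> contributes one signed squarefree monomial.
\<close>

definition schur :: "int_seq \<Rightarrow> int_seq \<Rightarrow> h_ring" where
  "schur \<mu> \<beta> = (\<Sum>S \<in> Pow (positive_pairs (len \<mu>)).
     (- 1) ^ card S * h_prod (raising_monomial S \<mu>) (raising_monomial S \<beta>))"

text \<open>
  The sequence \<open>(\<beta>\<^sub>1, \<dots>, \<beta>\<^sub>l, b)\<close>, padded with zeros.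
\<close>

definition truncate_snoc :: "nat \<Rightarrow> int_seq \<Rightarrow> int \<Rightarrow> int_seq" where
  "truncate_snoc l \<beta> b = (\<lambda>i. if i < l then \<beta> i else if i = l then b else 0)"

definition compositions :: "nat \<Rightarrow> nat \<Rightarrow> int_seq set" where
  "compositions p n = {\<sigma>. is_composition \<sigma> \<and> boxes \<sigma> = int p \<and> len \<sigma> \<le> n}"

lemma eq_0_if_len_le:
  assumes "int_vector \<alpha>" "len \<alpha> \<le> i"
  shows "\<alpha> i = 0"
proof (rule ccontr)
  assume a: "\<alpha> i \<noteq> 0"
  then have "\<alpha> \<noteq> 0" by auto
  moreover have "i \<le> Max {i. \<alpha> i \<noteq> 0}"
    using assms(1) a by (intro Max_ge) (auto simp: int_vector_def)
  ultimately show False using assms(2) by (simp add: len_def)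
qed

text \<open>In particular, a sum over \<open>compositions p n\<close> is a genuine finite sum.\<close>

lemma finite_compositions: "finite (compositions p n)"
proof (rule finite_subset)
  show "compositions p n \<subseteq>
    {\<sigma>. \<forall>i. (i \<in> {..<n} \<longrightarrow> \<sigma> i \<in> {0..int p}) \<and> (i \<notin> {..<n} \<longrightarrow> \<sigma> i = 0)}"
  proof (intro subsetI CollectI allI conjI impI)
    fix \<sigma> i assume s: "\<sigma> \<in> compositions p n"
    then have c: "finite {i. \<sigma> i \<noteq> 0}" "\<And>i. 0 \<le> \<sigma> i" "boxes \<sigma> = int p"
      and l: "int_vector \<sigma>" "len \<sigma> \<le> n"
      by (auto simp: compositions_def is_composition_def int_vector_def)
    show "\<sigma> i = 0" if "i \<notin> {..<n}"
      using eq_0_if_len_le[OF l(1)] l(2) that by auto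
    have "\<sigma> i \<le> int p"
    proof (cases "\<sigma> i = 0")
      case False
      then have "\<sigma> i \<le> boxes \<sigma>"
        unfolding boxes_def using c by (intro member_le_sum) auto
      then show ?thesis using c by simp
    qed simp
    then show "\<sigma> i \<in> {0..int p}" using c by simp
  qed
  show "finite {\<sigma>. \<forall>i. (i \<in> {..<n} \<longrightarrow> \<sigma> i \<in> {0..int p}) \<and> (i \<notin> {..<n} \<longrightarrow> \<sigma> i = (0::int))}"
    by (rule finite_set_of_finite_funs) auto
qed

end

theory Submission
  imports Defs
begin

text \<open>
  Since a composition \<open>\<sigma>\<close> shifts both indices, every factor in row \<open>i\<close> has the form
  \<open>h\<^bsub>m,\<gamma>\<^sub>i+m\<^esub>\<close> with a fixed \<open>\<gamma>\<^sub>i\<close>. Hence both sides are images of Laurent polynomials in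
  \<open>x\<^sub>0, \<dots>, x\<^sub>l\<close> under the linear map sending a monomial with exponent \<open>\<alpha>\<close> to the product of the
  \<open>h\<^bsub>\<alpha>\<^sub>i,\<gamma>\<^sub>i+\<alpha>\<^sub>i\<^esub>\<close>, which kills monomials with a negative exponent. The sum over \<open>\<sigma>\<close> becomes the
  complete homogeneous polynomial \<open>h\<^sub>p(x\<^sub>0, \<dots>, x\<^sub>l)\<close>, and its product with the factors
  \<open>1 - x\<^sub>s / x\<^sub>l\<close> is \<open>x\<^sub>l\<^sup>p\<close> up to monomials with a negative exponent at \<open>x\<^sub>l\<close>.
\<close>

section \<open>Laurent polynomials\<close>

type_synonym laurent = "int_seq \<Rightarrow>\<^sub>0 int"

abbreviation xmon :: "int_seq \<Rightarrow> laurent" where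
  "xmon \<alpha> \<equiv> frag_of \<alpha>"

abbreviation keys :: "('a \<Rightarrow>\<^sub>0 'b::zero) \<Rightarrow> 'a set" where
  "keys \<equiv> Poly_Mapping.keys"

definition unit_seq :: "nat \<Rightarrow> int_seq" where
  "unit_seq i = (\<lambda>j. if j = i then 1 else 0)"

lemma xmon_mult: "xmon \<alpha> * xmon \<beta> = xmon (\<alpha> + \<beta>)"
  by (simp add: mult_single)

lemma keys_mult_subset:
  fixes p q :: "'a::monoid_add \<Rightarrow>\<^sub>0 int"
  assumes "keys p \<subseteq> A" "keys q \<subseteq> B" "\<And>a b. a \<in> A \<Longrightarrow> b \<in> B \<Longrightarrow> a + b \<in> C"
  shows "keys (p * q) \<subseteq> C"
  using keys_mult[of p q] assms by fastforce

lemma keys_diff_subset: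
  fixes p q :: "'a \<Rightarrow>\<^sub>0 int"
  assumes "keys p \<subseteq> A" "keys q \<subseteq> A"
  shows "keys (p - q) \<subseteq> A"
  using keys_diff[of p q] assms by blast

lemma keys_sum_subset:
  fixes f :: "'i \<Rightarrow> 'a \<Rightarrow>\<^sub>0 int"
  assumes "\<And>i. i \<in> I \<Longrightarrow> keys (f i) \<subseteq> A"
  shows "keys (sum f I) \<subseteq> A"
  using keys_sum[of f I] assms by blast

lemma keys_prod_subset:
  fixes f :: "'i \<Rightarrow> 'a::comm_monoid_add \<Rightarrow>\<^sub>0 int"
  assumes "\<And>i. i \<in> I \<Longrightarrow> keys (f i) \<subseteq> A" "0 \<in> A" "\<And>a b. a \<in> A \<Longrightarrow> b \<in> A \<Longrightarrow> a + b \<in> A"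
  shows "keys (prod f I) \<subseteq> A"
  using assms(1)
proof (induction I rule: infinite_finite_induct)
  case (insert i I)
  then show ?case
    using assms(3) by (simp add: keys_mult_subset[where A = A and B = A])
qed (use assms(2) in auto)

text \<open>Multiplication by a monomial becomes a shift of exponents; this is how the power of
  \<open>x_l\<close> is later absorbed into the factor of row \<open>l\<close>.\<close>

lemma frag_extend_shift:
  fixes q :: laurent
  shows "frag_extend F (q * xmon \<delta>) = frag_extend (\<lambda>\<alpha>. F (\<alpha> + \<delta>)) q"
  using subset_UNIV
  by (induction q rule: frag_induction) (simp_all add: frag_extend_diff left_diff_distrib xmon_mult plus_fun_def)

lemma frag_extend_mult_left:
  fixes q :: laurent and c :: h_ring
  shows "frag_extend (\<lambda>\<alpha>. c * F \<alpha>) q = c * frag_extend F q"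
  using subset_UNIV
  by (induction q rule: frag_induction) (simp_all add: frag_extend_diff right_diff_distrib)

lemma frag_extend_signed: "frag_extend F ((- 1) ^ k * q) = (- 1) ^ k * frag_extend F q"
  for q :: laurent and F :: "int_seq \<Rightarrow> h_ring"
  by (cases "even k") (simp_all add: frag_extend_minus)

text \<open>These three sets serve as bounds for supports: no variable from \<open>x_n\<close> on,
  no positive power of \<open>x_n\<close>, only negative powers of \<open>x_n\<close>. Adding an
  element of either of the first two to one of \<open>seqs_neg n\<close> stays in
  \<open>seqs_neg n\<close>.\<close>

definition seqs_upto :: "nat \<Rightarrow> int_seq set" where
  "seqs_upto n = {\<alpha>. \<forall>i\<ge>n. \<alpha> i = 0}"

definition seqs_nonpos :: "nat \<Rightarrow> int_seq set" where
  "seqs_nonpos n = {\<alpha>. \<alpha> n \<le> 0}"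

definition seqs_neg :: "nat \<Rightarrow> int_seq set" where
  "seqs_neg n = {\<alpha>. \<alpha> n < 0}"

lemmas seqs_defs = seqs_upto_def seqs_nonpos_def seqs_neg_def

section \<open>Complete homogeneous polynomials\<close>

text \<open>Indexed by an arbitrary set of variables rather than a bound, because later inductions
  delete variables \<open>x_m\<close> while keeping \<open>x_n\<close> with
  \<open>n > m\<close>.\<close>

definition weak_compositions :: "nat set \<Rightarrow> nat \<Rightarrow> int_seq set" where
  "weak_compositions I p =
    {\<sigma>. (\<forall>i. 0 \<le> \<sigma> i) \<and> (\<forall>i. i \<notin> I \<longrightarrow> \<sigma> i = 0) \<and> (\<Sum>i\<in>I. \<sigma> i) = int p}"

definition complete_hom :: "nat set \<Rightarrow> nat \<Rightarrow> laurent" where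
  "complete_hom I p = (\<Sum>\<sigma>\<in>weak_compositions I p. xmon \<sigma>)"

lemma finite_weak_compositions:
  assumes "finite I"
  shows "finite (weak_compositions I p)"
proof (rule finite_subset)
  show "weak_compositions I p \<subseteq>
    {\<sigma>. \<forall>i. (i \<in> I \<longrightarrow> \<sigma> i \<in> {0..int p}) \<and> (i \<notin> I \<longrightarrow> \<sigma> i = 0)}"
  proof (intro subsetI CollectI allI conjI impI)
    fix \<sigma> i assume \<sigma>: "\<sigma> \<in> weak_compositions I p"
    then show "\<sigma> i = 0" if "i \<notin> I" using that by (simp add: weak_compositions_def)
    show "\<sigma> i \<in> {0..int p}" if "i \<in> I"
      using \<sigma> assms that member_le_sum[of i I \<sigma>] by (simp add: weak_compositions_def)
  qed
  show "finite {\<sigma>. \<forall>i. (i \<in> I \<longrightarrow> \<sigma> i \<in> {0..int p}) \<and> (i \<notin> I \<longrightarrow> \<sigma> i = (0::int))}"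
    using assms by (intro finite_set_of_finite_funs) auto
qed

lemma weak_compositions_0:
  assumes "finite I"
  shows "weak_compositions I 0 = {0}"
proof -
  have "\<sigma> = 0" if "\<sigma> \<in> weak_compositions I 0" for \<sigma>
    using that assms sum_nonneg_eq_0_iff[of I \<sigma>] by (fastforce simp: weak_compositions_def)
  then show ?thesis by (auto simp: weak_compositions_def)
qed

lemma complete_hom_0: "finite I \<Longrightarrow> complete_hom I 0 = 1"
  by (simp add: complete_hom_def weak_compositions_0)

lemma complete_hom_empty: "p > 0 \<Longrightarrow> complete_hom {} p = 0"
  by (simp add: complete_hom_def weak_compositions_def)

text \<open>Distinguish whether entry \<open>i\<close> vanishes; if it is positive, one box can be
  removed from it.\<close>

lemma weak_compositions_insert:
  assumes "finite I" "i \<notin> I"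
  shows "weak_compositions (insert i I) (Suc p) =
    weak_compositions I (Suc p) \<union> (\<lambda>\<sigma>. unit_seq i + \<sigma>) ` weak_compositions (insert i I) p"
    (is "?A = ?B \<union> ?f ` ?C")
proof (intro equalityI subsetI)
  fix \<sigma> assume \<sigma>: "\<sigma> \<in> ?A"
  show "\<sigma> \<in> ?B \<union> ?f ` ?C"
  proof (cases "\<sigma> i = 0")
    case True
    then show ?thesis using \<sigma> assms by (auto simp: weak_compositions_def)
  next
    case False
    then have "\<sigma> i > 0" using \<sigma> by (simp add: weak_compositions_def order_less_le)
    moreover have "(\<Sum>j\<in>I. (\<sigma> - unit_seq i) j) = (\<Sum>j\<in>I. \<sigma> j)"
      using assms by (intro sum.cong) (auto simp: unit_seq_def)
    ultimately have "\<sigma> - unit_seq i \<in> ?C"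
      using \<sigma> assms by (auto simp: weak_compositions_def unit_seq_def)
    then show ?thesis by (intro UnI2 image_eqI[of _ _ "\<sigma> - unit_seq i"]) simp_all
  qed
next
  fix \<sigma> assume "\<sigma> \<in> ?B \<union> ?f ` ?C"
  then show "\<sigma> \<in> ?A"
  proof
    assume "\<sigma> \<in> ?f ` ?C"
    then obtain \<tau> where \<tau>: "\<tau> \<in> ?C" "\<sigma> = unit_seq i + \<tau>" by auto
    have "(\<Sum>j\<in>I. (unit_seq i + \<tau>) j) = (\<Sum>j\<in>I. \<tau> j)"
      using assms by (intro sum.cong) (auto simp: unit_seq_def)
    then show ?thesis
      using \<tau> assms by (auto simp: weak_compositions_def unit_seq_def)
  qed (use assms in \<open>auto simp: weak_compositions_def\<close>)
qed

lemma complete_hom_insert: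
  assumes "finite I" "i \<notin> I"
  shows "complete_hom (insert i I) (Suc p) =
    complete_hom I (Suc p) + xmon (unit_seq i) * complete_hom (insert i I) p"
proof -
  have "weak_compositions I (Suc p) \<inter>
      (\<lambda>\<sigma>. unit_seq i + \<sigma>) ` weak_compositions (insert i I) p = {}"
  proof -
    have "\<sigma> i = 0" if "\<sigma> \<in> weak_compositions I (Suc p)" for \<sigma>
      using that assms by (simp add: weak_compositions_def)
    moreover have "(unit_seq i + \<sigma>) i > 0" if "\<sigma> \<in> weak_compositions (insert i I) p" for \<sigma>
      using that by (simp add: weak_compositions_def unit_seq_def add_pos_nonneg)
    ultimately show ?thesis by fastforce
  qed
  then show ?thesis
    using assms
    by (simp add: complete_hom_def weak_compositions_insert sum.union_disjoint
        finite_weak_compositions sum.reindex inj_on_def sum_distrib_left xmon_mult)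
qed

lemma keys_complete_hom: "keys (complete_hom I p) \<subseteq> weak_compositions I p"
  unfolding complete_hom_def by (rule keys_sum_subset) (auto simp: keys_frag_of)

text \<open>The Laurent monomial \<open>x_s / x_t\<close>; multiplying by it is the raising operator
  on exponents.\<close>

definition ratio :: "nat \<Rightarrow> nat \<Rightarrow> laurent" where
  "ratio s t = xmon (unit_seq s - unit_seq t)"

lemma keys_one_minus_ratio: "keys (1 - ratio s t) \<subseteq> {0, unit_seq s - unit_seq t}"
  by (intro keys_diff_subset) (auto simp: ratio_def)

text \<open>The two recursions for \<open>h\<^sub>p(X, x\<^sub>i, x\<^sub>n)\<close>, removing \<open>x\<^sub>i\<close> or \<open>x\<^sub>n\<close>, combine.\<close>

lemma complete_hom_times_one_minus_ratio:
  assumes "finite I" "i \<notin> I" "n \<notin> I" "i \<noteq> n"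
  shows "complete_hom (insert n (insert i I)) p * (1 - ratio i n) =
    complete_hom (insert n I) p - ratio i n * complete_hom (insert i I) p"
proof (cases p)
  case 0
  then show ?thesis using assms by (simp add: complete_hom_0)
next
  case (Suc k)
  let ?J = "insert n (insert i I)"
  have a: "complete_hom ?J p = complete_hom (insert n I) p + xmon (unit_seq i) * complete_hom ?J k"
    using complete_hom_insert[of "insert n I" i k] assms Suc by (simp add: insert_commute)
  have b: "complete_hom ?J p = complete_hom (insert i I) p + xmon (unit_seq n) * complete_hom ?J k"
    using complete_hom_insert[of "insert i I" n k] assms Suc by simp
  have c: "ratio i n * xmon (unit_seq n) = xmon (unit_seq i)"
    by (simp add: ratio_def xmon_mult)
  have "ratio i n * complete_hom ?J p =
      ratio i n * complete_hom (insert i I) p + (ratio i n * xmon (unit_seq n)) * complete_hom ?J k"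
    by (subst b) (simp add: algebra_simps)
  then have "complete_hom ?J p * (1 - ratio i n) = complete_hom ?J p -
      ratio i n * complete_hom (insert i I) p - xmon (unit_seq i) * complete_hom ?J k"
    by (simp add: c algebra_simps)
  then show ?thesis by (simp add: a)
qed

lemma complete_hom_singleton: "complete_hom {n} p = xmon (\<lambda>j. int p * unit_seq n j)"
proof (induction p)
  case 0
  show ?case by (simp add: complete_hom_0 flip: zero_fun_def)
next
  case (Suc p)
  have "unit_seq n + (\<lambda>j. int p * unit_seq n j) = (\<lambda>j. int (Suc p) * unit_seq n j)"
    by (auto simp: unit_seq_def)
  then show ?case
    using Suc complete_hom_insert[of "{}" n p] by (simp add: complete_hom_empty xmon_mult)
qed

lemma keys_prod_one_minus_ratio:
  assumes "m \<le> n"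
  shows "keys (\<Prod>s<m. 1 - ratio s n) \<subseteq> seqs_nonpos n"
proof (rule keys_prod_subset)
  show "keys (1 - ratio s n) \<subseteq> seqs_nonpos n" if "s \<in> {..<m}" for s
    using keys_one_minus_ratio[of s n] that assms by (auto simp: seqs_defs unit_seq_def)
qed (auto simp: seqs_defs)

text \<open>Induction on \<open>m\<close>: the factor \<open>1 - x_m / x_n\<close> deletes
  \<open>x_m\<close> from the complete homogeneous polynomial, up to an error carrying a negative
  power of \<open>x_n\<close>. For \<open>m = 0\<close> only \<open>x_n\<close> is left, and the
  difference is zero.\<close>

lemma keys_complete_hom_times_prod:
  assumes "m \<le> n"
  shows "keys (complete_hom (insert n {..<m}) p * (\<Prod>s<m. 1 - ratio s n)
    - xmon (\<lambda>j. int p * unit_seq n j)) \<subseteq> seqs_neg n"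
  using assms
proof (induction m)
  case 0
  show ?case by (simp add: complete_hom_singleton)
next
  case (Suc m)
  let ?P = "\<Prod>s<m. 1 - ratio s n" and ?x = "xmon (\<lambda>j. int p * unit_seq n j)"
  have "complete_hom (insert n {..<Suc m}) p * (\<Prod>s<Suc m. 1 - ratio s n) - ?x =
      (complete_hom (insert n (insert m {..<m})) p * (1 - ratio m n)) * ?P - ?x"
    by (simp add: lessThan_Suc mult_ac)
  also have "\<dots> = (complete_hom (insert n {..<m}) p * ?P - ?x)
      - (ratio m n * complete_hom (insert m {..<m}) p) * ?P"
    using Suc.prems by (subst complete_hom_times_one_minus_ratio) (auto simp: algebra_simps)
  also have "keys \<dots> \<subseteq> seqs_neg n"
  proof (rule keys_diff_subset)
    show "keys (complete_hom (insert n {..<m}) p * ?P - ?x) \<subseteq> seqs_neg n"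
      using Suc by simp
    \<comment> \<open>In the error term \<open>x_n\<close> has been deleted from the variables, so
      the negative power of \<open>x_n\<close> in \<open>ratio m n\<close> cannot be
      cancelled.\<close>
    have "keys (complete_hom (insert m {..<m}) p) \<subseteq> {\<alpha>. \<alpha> n = 0}"
      using keys_complete_hom[of "insert m {..<m}" p] Suc.prems
      by (auto simp: weak_compositions_def)
    moreover have "keys (ratio m n) \<subseteq> seqs_neg n"
      using Suc.prems by (auto simp: ratio_def seqs_defs unit_seq_def)
    ultimately have "keys (ratio m n * complete_hom (insert m {..<m}) p) \<subseteq> seqs_neg n"
      by (intro keys_mult_subset) (auto simp: seqs_defs)
    then show "keys (ratio m n * complete_hom (insert m {..<m}) p * ?P) \<subseteq> seqs_neg n"
      using keys_prod_one_minus_ratio[of m n] Suc.prems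
      by - (rule keys_mult_subset[of _ "seqs_neg n" _ "seqs_nonpos n"], auto simp: seqs_defs)
  qed
  finally show ?case .
qed

section \<open>Schur polynomials as images of Laurent polynomials\<close>

definition raising_product :: "nat \<Rightarrow> laurent" where
  "raising_product n = (\<Prod>(s, t)\<in>positive_pairs n. 1 - ratio s t)"

text \<open>The number of rows is fixed, independent of \<open>len \<alpha>\<close>, so that one
  linear map serves all exponents; a zero entry only contributes the factor 1.\<close>

definition shifted_h_prod :: "nat \<Rightarrow> int_seq \<Rightarrow> int_seq \<Rightarrow> h_ring" where
  "shifted_h_prod n \<gamma> \<alpha> = (\<Prod>i<n. h (\<alpha> i) (\<gamma> i + \<alpha> i))"

lemma finite_positive_pairs: "finite (positive_pairs n)"
  by (rule finite_subset[of _ "{..<n} \<times> {..<n}"]) (auto simp: positive_pairs_def)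

lemma raising_product_Suc: "raising_product (Suc n) = raising_product n * (\<Prod>s<n. 1 - ratio s n)"
proof -
  have "positive_pairs (Suc n) = positive_pairs n \<union> (\<lambda>s. (s, n)) ` {..<n}"
    by (auto simp: positive_pairs_def)
  moreover have "positive_pairs n \<inter> (\<lambda>s. (s, n)) ` {..<n} = {}"
    by (auto simp: positive_pairs_def)
  ultimately show ?thesis
    by (simp add: raising_product_def prod.union_disjoint finite_positive_pairs
        prod.reindex inj_on_def)
qed

lemma keys_raising_product: "keys (raising_product n) \<subseteq> seqs_upto n"
  unfolding raising_product_def
proof (rule keys_prod_subset)
  show "keys (case st of (s, t) \<Rightarrow> 1 - ratio s t) \<subseteq> seqs_upto n"
    if "st \<in> positive_pairs n" for st
    using keys_one_minus_ratio[of "fst st" "snd st"] that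
    by (auto simp: seqs_defs unit_seq_def positive_pairs_def)
qed (auto simp: seqs_defs)

lemma shifted_h_prod_neg:
  assumes "i < n" "\<alpha> i < 0"
  shows "shifted_h_prod n \<gamma> \<alpha> = 0"
  unfolding shifted_h_prod_def using assms
  by (intro prod_zero) (auto simp: h_def intro!: bexI[of _ i])

text \<open>Turns bounds on supports into identities in the ring: an error term with only negative
  powers of some \<open>x_i\<close> is killed, provided row \<open>i\<close> is among the
  \<open>n\<close> rows.\<close>

lemma frag_extend_shifted_h_prod_neg:
  assumes "keys q \<subseteq> seqs_neg i" "i < n"
  shows "frag_extend (shifted_h_prod n \<gamma>) q = 0"
  using assms by (intro frag_extend_eq_0) (auto simp: seqs_defs intro: shifted_h_prod_neg)

lemma raising_monomial_eq:
  assumes "finite S"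
  shows "raising_monomial S \<alpha> = \<alpha> + (\<Sum>(s, t)\<in>S. unit_seq s - unit_seq t)"
  using assms
proof (induction S rule: finite_induct)
  case (insert st S)
  then show ?case
    by (auto simp: raising_monomial_insert raising_def unit_seq_def fun_eq_iff split: prod.splits)
qed simp

lemma xmon_raising_monomial:
  assumes "finite S"
  shows "xmon (raising_monomial S \<alpha>) = xmon \<alpha> * (\<Prod>(s, t)\<in>S. ratio s t)"
  using assms
proof (induction S rule: finite_induct)
  case (insert st S)
  have "raising_monomial (insert st S) \<alpha> =
      (unit_seq (fst st) - unit_seq (snd st)) + raising_monomial S \<alpha>"
    using insert(1,2) by (simp add: raising_monomial_eq case_prod_beta algebra_simps)
  then have "xmon (raising_monomial (insert st S) \<alpha>) =
      ratio (fst st) (snd st) * xmon (raising_monomial S \<alpha>)"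
    by (simp only: ratio_def xmon_mult)
  then show ?case
    using insert by (simp add: case_prod_beta mult_ac)
qed simp

section \<open>Schur polynomials with a flexible number of rows\<close>

lemma sum_pairs_outside:
  assumes "S \<subseteq> positive_pairs n" "n \<le> i"
  shows "(\<Sum>(s, t)\<in>S. unit_seq s - unit_seq t) i = 0"
proof -
  have "finite S" using assms finite_positive_pairs finite_subset by blast
  then show ?thesis using assms
    by (induction S rule: finite_induct) (auto simp: unit_seq_def positive_pairs_def)
qed

lemma len_le:
  assumes "\<And>i. n \<le> i \<Longrightarrow> \<alpha> i = 0"
  shows "len \<alpha> \<le> n"
proof (cases "\<alpha> = 0")
  case False
  have sub: "{i. \<alpha> i \<noteq> 0} \<subseteq> {..<n}" using assms not_le by auto
  then have "finite {i. \<alpha> i \<noteq> 0}" using finite_subset by blast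
  then have "Max {i. \<alpha> i \<noteq> 0} \<in> {i. \<alpha> i \<noteq> 0}"
    using False by (intro Max_in) auto
  then show ?thesis using sub False by (auto simp: len_def)
qed (simp add: len_def)

lemma int_vector_if_upto:
  assumes "\<alpha> \<in> seqs_upto n"
  shows "int_vector \<alpha>"
proof -
  have "{i. \<alpha> i \<noteq> 0} \<subseteq> {..<n}"
    using assms not_le by (auto simp: seqs_upto_def)
  then show ?thesis unfolding int_vector_def using finite_subset by blast
qed

text \<open>Zero entries give factors \<open>h 0 _ = 1\<close>, so the length, which raising
  operators can change, may be replaced by any bound for it.\<close>

lemma h_prod_eq:
  assumes "\<alpha> \<in> seqs_upto n"
  shows "h_prod \<alpha> \<beta> = (\<Prod>i<n. h (\<alpha> i) (\<beta> i))"
  unfolding h_prod_def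
proof (rule prod.mono_neutral_left)
  show "{..<len \<alpha>} \<subseteq> {..<n}" using assms len_le[of n \<alpha>] by (auto simp: seqs_upto_def)
  show "\<forall>i\<in>{..<n} - {..<len \<alpha>}. h (\<alpha> i) (\<beta> i) = 1"
    using eq_0_if_len_le[OF int_vector_if_upto[OF assms]] by (simp add: h_def)
qed simp

text \<open>Raising operators change both indices equally, so their difference \<gamma> is
  preserved. Expanding the product of all \<open>1 - x_s / x_t\<close> over subsets then matches the
  definition of \<open>schur\<close> term by term.\<close>

lemma schur_eq_len:
  assumes "int_vector \<mu>" "len \<mu> \<le> N" "\<And>i. i < len \<mu> \<Longrightarrow> \<beta> i = \<gamma> i + \<mu> i"
  shows "schur \<mu> \<beta> = frag_extend (shifted_h_prod N \<gamma>) (xmon \<mu> * raising_product (len \<mu>))"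
proof -
  let ?P = "positive_pairs (len \<mu>)" and ?F = "frag_extend (shifted_h_prod N \<gamma>)"
  have summand: "h_prod (raising_monomial S \<mu>) (raising_monomial S \<beta>) =
      shifted_h_prod N \<gamma> (raising_monomial S \<mu>)" if "S \<subseteq> ?P" for S
  proof -
    have fin: "finite S" using that finite_positive_pairs finite_subset by blast
    define r where "r = (\<Sum>(s, t)\<in>S. unit_seq s - unit_seq t)"
    have R: "raising_monomial S \<mu> = \<mu> + r" "raising_monomial S \<beta> = \<beta> + r"
      using fin by (simp_all add: raising_monomial_eq r_def)
    have "\<mu> + r \<in> seqs_upto (len \<mu>)"
      using eq_0_if_len_le[OF assms(1)] sum_pairs_outside[OF that]
      by (simp add: seqs_upto_def r_def)
    then have "h_prod (\<mu> + r) (\<beta> + r) = (\<Prod>i<len \<mu>. h ((\<mu> + r) i) ((\<beta> + r) i))"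
      by (rule h_prod_eq)
    also have "\<dots> = (\<Prod>i<len \<mu>. h ((\<mu> + r) i) (\<gamma> i + (\<mu> + r) i))"
      using assms(3) by (intro prod.cong) (auto simp: add_ac)
    also have "\<dots> = shifted_h_prod N \<gamma> (\<mu> + r)"
      unfolding shifted_h_prod_def using assms(2) \<open>\<mu> + r \<in> seqs_upto (len \<mu>)\<close>
      by (intro prod.mono_neutral_left) (auto simp: seqs_upto_def h_def)
    finally show ?thesis by (simp add: R)
  qed
  have "raising_product (len \<mu>) = (\<Sum>S\<in>Pow ?P. (- 1) ^ card S * (\<Prod>(s, t)\<in>S. ratio s t))"
    using prod_diff_conv_sum[OF finite_positive_pairs, of "\<lambda>_. 1" "\<lambda>(s, t). ratio s t" "len \<mu>"]
    by (simp add: raising_product_def case_prod_beta)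
  then have "xmon \<mu> * raising_product (len \<mu>) =
      (\<Sum>S\<in>Pow ?P. (- 1) ^ card S * (xmon \<mu> * (\<Prod>(s, t)\<in>S. ratio s t)))"
    by (simp add: sum_distrib_left mult_ac)
  also have "\<dots> = (\<Sum>S\<in>Pow ?P. (- 1) ^ card S * xmon (raising_monomial S \<mu>))"
    by (intro sum.cong refl)
      (metis PowD finite_positive_pairs finite_subset xmon_raising_monomial)
  finally have "?F (xmon \<mu> * raising_product (len \<mu>)) =
      (\<Sum>S\<in>Pow ?P. (- 1) ^ card S * shifted_h_prod N \<gamma> (raising_monomial S \<mu>))"
    by (simp add: frag_extend_sum finite_positive_pairs frag_extend_signed)
  then show ?thesis by (simp add: schur_def summand)
qed

text \<open>Rows of zeros may be appended: the new factors \<open>1 - x_s / x_n\<close> contribute 1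
  plus terms with a negative power of \<open>x_n\<close>, which are killed. This treats all
  \<open>\<mu> + \<sigma>\<close> uniformly, although their length may be \<open>l\<close> or
  \<open>l + 1\<close>.\<close>

lemma schur_eq:
  assumes "int_vector \<mu>" "len \<mu> \<le> n" "n \<le> N" "\<And>i. i < len \<mu> \<Longrightarrow> \<beta> i = \<gamma> i + \<mu> i"
  shows "schur \<mu> \<beta> = frag_extend (shifted_h_prod N \<gamma>) (xmon \<mu> * raising_product n)"
  using assms(2,3)
proof (induction n rule: dec_induct)
  case base
  then show ?case using assms by (intro schur_eq_len) auto
next
  case (step n)
  let ?q = "xmon \<mu> * raising_product n" and ?P = "\<Prod>s<n. 1 - ratio s n"
  have "keys (?q * (?P - 1)) \<subseteq> seqs_neg n"
  proof (intro keys_mult_subset)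
    show "keys (xmon \<mu>) \<subseteq> {\<alpha>. \<alpha> n = 0}"
      using eq_0_if_len_le[OF assms(1)] step by simp
    show "keys (raising_product n) \<subseteq> seqs_upto n" by (rule keys_raising_product)
    show "keys (?P - 1) \<subseteq> seqs_neg n"
      \<comment> \<open>With \<open>p = 0\<close> both the complete homogeneous polynomial and the
        power of \<open>x_n\<close> are 1.\<close>
      using keys_complete_hom_times_prod[of n n 0] by (simp add: complete_hom_0 flip: zero_fun_def)
    show "a + b \<in> {\<alpha>. \<alpha> n = 0}" if "a \<in> {\<alpha>. \<alpha> n = 0}" "b \<in> seqs_upto n" for a b
      using that by (simp add: seqs_defs)
    show "a + b \<in> seqs_neg n" if "a \<in> {\<alpha>. \<alpha> n = 0}" "b \<in> seqs_neg n" for a b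
      using that by (simp add: seqs_defs)
  qed
  then have "frag_extend (shifted_h_prod N \<gamma>) (?q * (?P - 1)) = 0"
    using step by (intro frag_extend_shifted_h_prod_neg) auto
  moreover have "xmon \<mu> * raising_product (Suc n) = ?q + ?q * (?P - 1)"
    by (simp add: raising_product_Suc algebra_simps)
  ultimately show ?case
    using step by (simp add: frag_extend_add)
qed

section \<open>The Pieri rule\<close>

lemma compositions_eq_weak_compositions: "compositions p n = weak_compositions {..<n} p"
proof -
  have "boxes \<sigma> = (\<Sum>i<n. \<sigma> i)" if "\<sigma> \<in> seqs_upto n" for \<sigma>
    unfolding boxes_def using that not_le
    by (intro sum.mono_neutral_left) (auto simp: seqs_upto_def)
  moreover have "\<sigma> \<in> seqs_upto n \<longleftrightarrow> int_vector \<sigma> \<and> len \<sigma> \<le> n" for \<sigma>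
    using int_vector_if_upto[of \<sigma> n] len_le[of n \<sigma>] eq_0_if_len_le[of \<sigma>]
    by (auto simp: seqs_upto_def)
  moreover have "\<sigma> \<in> seqs_upto n \<longleftrightarrow> (\<forall>i. i \<notin> {..<n} \<longrightarrow> \<sigma> i = 0)" for \<sigma>
    by (auto simp: seqs_upto_def not_less)
  ultimately show ?thesis
    by (auto simp: compositions_def weak_compositions_def is_composition_def)
qed

theorem proposition2p3:
  fixes \<beta> \<mu> :: int_seq and p e :: nat
  assumes "is_partition \<mu>" and "p > 0" and "e > 0"
  defines "\<beta>' \<equiv> truncate_snoc (len \<mu>) \<beta> (\<beta> (e - 1) - int p)"
  shows "h (int p) (\<beta> (e - 1)) * schur \<mu> \<beta> =
    (\<Sum>\<sigma> \<in> compositions p (len \<mu> + 1). schur (\<mu> + \<sigma>) (\<beta>' + \<sigma>))"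
proof -
  define l where "l = len \<mu>"
  \<comment> \<open>The same offset works for every \<sigma>, since \<sigma> is added to both
    sequences.\<close>
  define \<gamma> where "\<gamma> = \<beta>' - \<mu>"
  have iv: "int_vector \<mu>"
    using assms(1) by (simp add: is_partition_def is_composition_def)
  have \<mu>0: "\<mu> i = 0" if "l \<le> i" for i
    using eq_0_if_len_le[OF iv] that by (simp add: l_def)
  let ?F = "frag_extend (shifted_h_prod (Suc l) \<gamma>)"
  let ?q = "xmon \<mu> * raising_product l" and ?P = "\<Prod>s<l. 1 - ratio s l"
  let ?z = "xmon (\<lambda>j. int p * unit_seq l j)"
  let ?r = "complete_hom (insert l {..<l}) p * ?P - ?z"
  \<comment> \<open>\<open>?q\<close> does not involve \<open>x_l\<close>, so it neither cancels the
    negative powers in \<open>?r\<close> nor affects the power of \<open>x_l\<close> in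
    \<open>?z\<close>.\<close>
  have keys_q: "keys ?q \<subseteq> seqs_upto l"
    using \<mu>0 keys_raising_product
    by (intro keys_mult_subset[of _ "seqs_upto l" _ "seqs_upto l"]) (auto simp: seqs_upto_def)
  have "schur (\<mu> + \<sigma>) (\<beta>' + \<sigma>) = ?F (xmon \<sigma> * (xmon \<mu> * raising_product (Suc l)))"
    if "\<sigma> \<in> compositions p (len \<mu> + 1)" for \<sigma>
  proof -
    have up: "\<mu> + \<sigma> \<in> seqs_upto (Suc l)"
      using that \<mu>0
      by (simp add: compositions_eq_weak_compositions weak_compositions_def seqs_upto_def l_def)
    have "schur (\<mu> + \<sigma>) (\<beta>' + \<sigma>) = ?F (xmon (\<mu> + \<sigma>) * raising_product (Suc l))"
      using up by (intro schur_eq int_vector_if_upto[OF up] len_le) (auto simp: \<gamma>_def seqs_upto_def)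
    then show ?thesis by (simp add: mult_ac flip: xmon_mult)
  qed
  then have "(\<Sum>\<sigma> \<in> compositions p (len \<mu> + 1). schur (\<mu> + \<sigma>) (\<beta>' + \<sigma>)) =
      ?F (\<Sum>\<sigma>\<in>compositions p (len \<mu> + 1). xmon \<sigma> * (xmon \<mu> * raising_product (Suc l)))"
    by (simp add: frag_extend_sum[OF finite_compositions] o_def)
  also have "(\<Sum>\<sigma>\<in>compositions p (len \<mu> + 1). xmon \<sigma> * (xmon \<mu> * raising_product (Suc l))) =
      complete_hom {..<Suc l} p * (xmon \<mu> * raising_product (Suc l))"
    by (simp add: complete_hom_def compositions_eq_weak_compositions l_def sum_distrib_right)
  also have "\<dots> = ?q * (complete_hom (insert l {..<l}) p * ?P)"
    by (simp add: raising_product_Suc lessThan_Suc mult_ac)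
  also have "\<dots> = ?q * ?z + ?q * ?r"
    by (simp add: right_diff_distrib)
  also have "?F \<dots> = ?F (?q * ?z)"
  proof -
    have "keys (?q * ?r) \<subseteq> seqs_neg l"
      by (rule keys_mult_subset[OF keys_q keys_complete_hom_times_prod])
        (auto simp: seqs_defs)
    then show ?thesis by (simp add: frag_extend_add frag_extend_shifted_h_prod_neg)
  qed
  \<comment> \<open>Row \<open>l\<close> had the factor \<open>h 0 _ = 1\<close>. After
    multiplication by \<open>?z\<close> its indices are \<open>p\<close> and
    \<open>\<gamma> l + p\<close>, and the latter is \<open>\<beta> (e - 1)\<close> by the choice of
    the last entry of \<open>\<beta>'\<close>.\<close>
  also have "\<dots> = frag_extend (\<lambda>\<alpha>. h (int p) (\<beta> (e - 1)) * shifted_h_prod (Suc l) \<gamma> \<alpha>) ?q"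
    unfolding frag_extend_shift
  proof (rule frag_extend_eq)
    fix \<alpha> assume "\<alpha> \<in> keys ?q"
    then have "\<alpha> l = 0" using keys_q by (auto simp: seqs_upto_def)
    moreover have "\<gamma> l = \<beta> (e - 1) - int p"
      using \<mu>0 by (simp add: \<gamma>_def \<beta>'_def truncate_snoc_def l_def)
    ultimately show "shifted_h_prod (Suc l) \<gamma> (\<alpha> + (\<lambda>j. int p * unit_seq l j)) =
        h (int p) (\<beta> (e - 1)) * shifted_h_prod (Suc l) \<gamma> \<alpha>"
      by (simp add: shifted_h_prod_def unit_seq_def h_def[of 0])
  qed
  also have "\<dots> = h (int p) (\<beta> (e - 1)) * ?F ?q"
    by (rule frag_extend_mult_left)
  also have "?F ?q = schur \<mu> \<beta>"
    \<comment> \<open>Here \<open>l\<close> rows of raising operators are combined with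
      \<open>Suc l\<close> rows of factors; on the first \<open>l\<close> rows
      \<open>\<gamma> + \<mu>\<close> agrees with \<beta>.\<close>
    by (rule schur_eq[OF iv, symmetric])
      (auto simp: \<gamma>_def \<beta>'_def truncate_snoc_def l_def)
  finally show ?thesis ..
qed

end
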